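(* Let $\mathbb{F}$ be the algebraic closure of $\mathbb{F}_p$ where $p$ is an odd prime. Let $H$ be the Heisenberg Lie algebra over $\mathbb{F}$, let $\psi:H\to\mathfrak{gl}(I)$ be a faithful representation, and suppose that the semidirect sum $L=H\ltimes_\psi I$ is non-nilpotent. If $L$ has a non-singular derivation $\delta$ of finite order such that $\delta(I)\leq I$, then $\dim I\geq p+3$.
   Context: The Heisenberg Lie algebra over $\mathbb{F}$ is the 3-dimensional Lie algebra with basis $x,y,z$ and brackets $[x,y]=z$, $[x,z]=[y,z]=0$. For a representation $\psi:H\to\mathfrak{gl}(I)$, with $I$ regarded as an abelian Lie algebra, $H\ltimes_\psi I$ is the vector space $H\oplus I$ with bracket $[(h_1,v_1),(h_2,v_2)]=([h_1,h_2],\,\psi(h_1)(v_2)-\psi(h_2)(v_1))$. A derivation $\delta$ is non-singular if it is an invertible linear map; it has finite order if $\delta^n=\mathrm{id}$ for some $n\geq 1$. *)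

theory Defs
  imports
    "HOL-Analysis.Product_Vector"
    "HOL-Library.Extended_Nat"
    "HOL-Algebra.Algebraic_Closure_Type"
    "Berlekamp_Zassenhaus.Finite_Field"
begin

text \<open>
  The algebraic closure of the prime field with \<open>p\<close> elements is the type
  \<open>'p mod_ring alg_closure\<close> with \<open>'p :: prime_card\<close>, where \<open>p = CARD('p)\<close>.
  Vector spaces and Lie algebras are carried by whole types, with an explicit scalar
  multiplication as in \<open>HOL.Vector_Spaces\<close>.
\<close>

text \<open>
  The library's \<open>dim\<close> is the junk value 0 on spaces without a finite basis; the extended
  dimension is infinite there.
\<close>
definition (in vector_space) edim :: enat
  where "edim = (if \<exists>B. finite B \<and> span B = UNIV then enat (dim UNIV) else \<infinity>)"

locale lie_algebra = vector_space scale
  for scale :: "'k::field \<Rightarrow> 'l::ab_group_add \<Rightarrow> 'l" +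
  fixes bracket :: "'l \<Rightarrow> 'l \<Rightarrow> 'l"
  assumes bracket_add_left: "bracket (x + y) z = bracket x z + bracket y z"
    and bracket_add_right: "bracket x (y + z) = bracket x y + bracket x z"
    and bracket_scale_left: "bracket (scale c x) y = scale c (bracket x y)"
    and bracket_scale_right: "bracket x (scale c y) = scale c (bracket x y)"
    and bracket_self: "bracket x x = 0"
    and jacobi: "bracket x (bracket y z) + bracket y (bracket z x) + bracket z (bracket x y) = 0"
begin

primrec lower_central_series :: "nat \<Rightarrow> 'l set" where
  "lower_central_series 0 = UNIV"
| "lower_central_series (Suc n) = span {bracket x y | x y. y \<in> lower_central_series n}"

definition nilpotent :: bool
  where "nilpotent \<longleftrightarrow> (\<exists>n. lower_central_series n = {0})"

definition derivation :: "('l \<Rightarrow> 'l) \<Rightarrow> bool"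
  where "derivation d \<longleftrightarrow> Vector_Spaces.linear scale scale d \<and>
    (\<forall>x y. d (bracket x y) = bracket (d x) y + bracket x (d y))"

end

locale heisenberg_algebra = lie_algebra +
  assumes heisenberg_basis: "\<exists>x y z. distinct [x, y, z] \<and> independent {x, y, z} \<and>
    span {x, y, z} = UNIV \<and> bracket x y = z \<and> bracket x z = 0 \<and> bracket y z = 0"

text \<open>
  A homomorphism of Lie algebras into the linear endomorphisms of a vector space, with the
  commutator bracket.
\<close>
locale lie_representation = L: lie_algebra scale bracket + V: vector_space scaleV
  for scale :: "'k::field \<Rightarrow> 'l::ab_group_add \<Rightarrow> 'l"
    and bracket :: "'l \<Rightarrow> 'l \<Rightarrow> 'l"
    and scaleV :: "'k \<Rightarrow> 'v::ab_group_add \<Rightarrow> 'v" +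
  fixes rep :: "'l \<Rightarrow> 'v \<Rightarrow> 'v"
  assumes rep_linear: "Vector_Spaces.linear scaleV scaleV (rep x)"
    and rep_add: "rep (x + y) v = rep x v + rep y v"
    and rep_scale: "rep (scale c x) v = scaleV c (rep x v)"
    and rep_bracket: "rep (bracket x y) v = rep x (rep y v) - rep y (rep x v)"

fun semidirect_bracket ::
  "('l \<Rightarrow> 'l \<Rightarrow> 'l) \<Rightarrow> ('l \<Rightarrow> 'v \<Rightarrow> 'v::ab_group_add) \<Rightarrow> 'l \<times> 'v \<Rightarrow> 'l \<times> 'v \<Rightarrow> 'l \<times> 'v"
  where "semidirect_bracket bracket rep (h1, v1) (h2, v2) =
    (bracket h1 h2, rep h1 v2 - rep h2 v1)"

lemma (in lie_representation) lie_algebra_semidirect: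
  "lie_algebra (module_prod.scale scale scaleV) (semidirect_bracket bracket rep)"
proof -
  interpret P: vector_space_prod scale scaleV
    by unfold_locales
  interpret rep: Vector_Spaces.linear scaleV scaleV "rep x" for x
    by (rule rep_linear)
  show ?thesis
  proof (unfold_locales, goal_cases)
    case (1 x y z)
    show ?case by (cases x; cases y; cases z)
        (simp add: L.bracket_add_left rep_add rep.add algebra_simps)
  next
    case (2 x y z)
    show ?case by (cases x; cases y; cases z)
        (simp add: L.bracket_add_right rep_add rep.add algebra_simps)
  next
    case (3 c x y)
    show ?case by (cases x; cases y)
        (simp add: P.scale_prod L.bracket_scale_left rep_scale rep.scale
          V.scale_right_diff_distrib)
  next
    case (4 x c y)
    show ?case by (cases x; cases y)
        (simp add: P.scale_prod L.bracket_scale_right rep_scale rep.scale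
          V.scale_right_diff_distrib)
  next
    case (5 x)
    show ?case by (cases x) (simp add: L.bracket_self zero_prod_def)
  next
    case (6 x y z)
    show ?case by (cases x; cases y; cases z)
        (simp add: L.jacobi rep_bracket rep.diff zero_prod_def)
  qed
qed

end

theory Submission
  imports Defs
begin

text \<open>
  A power of \<open>\<delta>\<close> with exponent a power of \<open>p\<close> is again a derivation, and a suitable one has order
  prime to \<open>p\<close>, hence is diagonalizable. It induces a derivation of \<open>H\<close> with non-commuting eigenvectors
  \<open>x\<close>, \<open>y\<close>; put \<open>z = [x, y]\<close>. The eigenvalues \<open>a\<close>, \<open>b\<close>, \<open>a + b\<close> of \<open>x\<close>, \<open>y\<close>, \<open>z\<close> are nonzero, and
  these elements act on \<open>I\<close> by shifting the eigenspaces of \<open>\<delta>\<close> by \<open>a\<close>, \<open>b\<close>, \<open>a + b\<close>. Hence if \<open>T\<close> is one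
  of them, \<open>S\<close> is a \<open>\<delta>\<close>-invariant subspace with \<open>T\<^sup>-\<^sup>1 S \<subseteq> S\<close>, and \<open>w\<close> is an eigenvector outside \<open>S\<close>, then
  \<open>w, T w, \<dots>, T\<^sup>p\<^sup>-\<^sup>1 w\<close> have distinct eigenvalues and are linearly independent modulo \<open>S\<close>: the
  codimension of \<open>S\<close> is at least \<open>p\<close>.

  As \<open>L\<close> is not nilpotent, \<open>x\<close>, \<open>y\<close> or \<open>z\<close> acts non-nilpotently. If \<open>z\<close> does, a cyclic \<open>z\<close>-submodule
  generated by an eigenvector is not all of the part where \<open>z\<close> is invertible, since \<open>x\<close> and \<open>y\<close> do not
  commute there; this gives dimension at least \<open>2 p\<close>. If \<open>z\<close> acts nilpotently but, say, \<open>x\<close> does not,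
  split \<open>I\<close> into the Fitting components of \<open>x\<close>. Either \<open>z \<noteq> 0\<close> on the component where \<open>x\<close> is invertible,
  and then the image of \<open>z\<close> and its cokernel there contribute \<open>p\<close> each; or \<open>z \<noteq> 0\<close> on the null component,
  which then has dimension at least 3, while the other component has dimension at least \<open>p\<close>.
\<close>

section \<open>Endomorphisms of finite order prime to the characteristic\<close>

text \<open>The polynomial \<open>X^m - 1\<close> splits over an algebraically closed field, and a
  double root would also be a root of \<open>m X^(m-1)\<close>, whose only root is 0. So its
  \<open>m\<close> roots are distinct.\<close>

lemma card_roots_of_unity:
  assumes "of_nat m \<noteq> (0 :: 'k :: alg_closed_field)"
  shows "card {x :: 'k. x ^ m = 1} = m"
proof -
  define p :: "'k poly" where "p = monom 1 m - 1"
  have m: "m > 0"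
    using assms by (cases m) auto
  have deg: "degree p = m"
    using m unfolding p_def by (subst diff_conv_add_uminus, subst degree_add_eq_left) (auto simp: degree_monom_eq)
  have p0: "p \<noteq> 0"
    using deg m by auto
  have poly_p: "poly p x = x ^ m - 1" for x
    by (simp add: p_def poly_monom)
  obtain A where A: "size A = degree p" "p = smult (lead_coeff p) (\<Prod>x\<in>#A. [:-x, 1:])"
    using alg_closed_imp_factorization[OF p0] by blast
  have lc: "lead_coeff p \<noteq> 0"
    using p0 by simp
  have "proots (\<Prod>x\<in>#A. [:-x, 1:]) = A"
  proof -
    have "0 \<notin># image_mset (\<lambda>x. [:-x, 1:]) A"
      by (auto dest: sym)
    from proots_prod_mset[OF this] show ?thesis
      by (simp add: image_mset.compositionality comp_def)
  qed
  then have A_roots: "A = proots p"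
    using lc by (subst A(2)) simp
  have "order x p \<le> 1" for x
  proof (rule ccontr)
    assume "\<not> order x p \<le> 1"
    then have "[:-x, 1:] ^ 2 dvd p"
      by (simp add: order_divides)
    then obtain q where q: "p = [:-x, 1:] ^ 2 * q"
      by auto
    have "poly p x = 0" and "poly (pderiv p) x = 0"
      unfolding q power2_eq_square pderiv_mult poly_add poly_mult by simp_all
    then have "x ^ m = 1" and "of_nat m * x ^ (m - 1) = 0"
      by (simp_all add: poly_p) (simp add: p_def pderiv_diff pderiv_monom poly_monom)
    then show False
      using assms m by (cases "x = 0") (auto simp: power_0_left)
  qed
  then have "count A x \<le> 1" for x
    using p0 by (simp add: A_roots)
  then have "A = mset_set (set_mset A)"
    by (intro multiset_eqI) (metis count_mset_set(1,3) count_greater_eq_one_iff finite_set_mset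
        le_antisym not_in_iff)
  then have "size A = card (set_mset A)"
    by (metis size_mset_set)
  then show ?thesis
    using A(1) p0 by (simp add: A_roots deg poly_p)
qed



context vector_space
begin

lemma linear_funpow:
  assumes "Vector_Spaces.linear scale scale f"
  shows "Vector_Spaces.linear scale scale (f ^^ n)"
proof (induction n)
  case (Suc n)
  then show ?case
    using assms unfolding funpow.simps by (rule Vector_Spaces.linear_compose)
qed (simp add: linear_ident id_def)

lemma funpow_eigenvector:
  assumes "Vector_Spaces.linear scale scale f" and "f w = scale c w"
  shows "(f ^^ n) w = scale (c ^ n) w"
proof -
  interpret f: Vector_Spaces.linear scale scale f by fact
  show ?thesis
    by (induction n) (simp_all add: f.scale assms(2))
qed

end

locale finite_order_endomorphism = vector_space scale
  for scale :: "'k::alg_closed_field \<Rightarrow> 'v::ab_group_add \<Rightarrow> 'v" +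
  fixes D :: "'v \<Rightarrow> 'v" and m :: nat
  assumes D_linear: "Vector_Spaces.linear scale scale D"
    and D_order: "D ^^ m = id"
    and m_nonzero: "of_nat m \<noteq> (0 :: 'k)"
begin

sublocale D: Vector_Spaces.linear scale scale D
  by (rule D_linear)

text \<open>
  The projection onto the \<open>c\<close>-eigenspace, for \<open>c\<close> an \<open>m\<close>-th root of unity: a discrete Fourier
  transform along the cyclic group generated by \<open>D\<close>.
\<close>
definition proj :: "'k \<Rightarrow> 'v \<Rightarrow> 'v"
  where "proj c u = scale (inverse (of_nat m)) (\<Sum>i<m. scale (inverse c ^ i) ((D ^^ i) u))"

lemma m_pos: "m > 0"
  using m_nonzero by (cases m) auto

lemma linear_proj: "Vector_Spaces.linear scale scale (proj c)"
proof -
  interpret vector_space_pair scale scale ..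
  show ?thesis
    unfolding proj_def
    by (rule linear_compose_scale_right[OF linear_compose_sum])
      (use linear_compose_scale_right[OF linear_funpow[OF D_linear]] in blast)
qed

text \<open>Up to the factor \<open>c\<close>, \<open>D\<close> moves each summand to the next; the
  cycle closes because \<open>D^m = id\<close> and \<open>c^m = 1\<close>.\<close>

lemma D_proj:
  assumes "c ^ m = 1"
  shows "D (proj c u) = scale c (proj c u)"
proof -
  have c: "c \<noteq> 0"
    using assms m_pos by (auto simp: power_0_left)
  define f where "f i = scale (inverse c ^ i) ((D ^^ i) u)" for i
  have f_m: "f m = f 0"
    using assms by (simp add: f_def D_order power_inverse)
  have "D (f i) = scale c (f (Suc i))" for i
    using c by (simp add: f_def D.scale mult.assoc[symmetric])
  then have "D (\<Sum>i<m. f i) = scale c (\<Sum>i<m. f (Suc i))"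
    by (simp add: D.sum scale_sum_right)
  also have "(\<Sum>i<m. f (Suc i)) = (\<Sum>i<m. f i)"
    using f_m by (metis add.commute add_left_cancel sum.lessThan_Suc sum.lessThan_Suc_shift)
  finally show ?thesis
    unfolding proj_def f_def by (simp add: D.scale mult.commute)
qed

lemma proj_subspace:
  assumes "subspace S" and "D ` S \<subseteq> S" and "u \<in> S"
  shows "proj c u \<in> S"
proof -
  have "(D ^^ i) u \<in> S" for i
    using assms(2,3) by (induction i) auto
  then show ?thesis
    unfolding proj_def using assms(1) by (intro subspace_scale subspace_sum) auto
qed

lemma eigenvalue_root_of_unity:
  assumes "D w = scale c w" and "w \<noteq> 0"
  shows "c ^ m = 1"
proof -
  have "scale (c ^ m) w = scale 1 w"
    using funpow_eigenvector[OF D_linear assms(1), of m] by (simp add: D_order)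
  then show ?thesis
    using assms(2) by (simp only: scale_cancel_right) simp
qed

lemma proj_eigenvector:
  assumes "D w = scale c w" and "w \<noteq> 0" and "b ^ m = 1"
  shows "proj b w = (if b = c then w else 0)"
proof -
  have b: "b \<noteq> 0"
    using assms(3) m_pos by (auto simp: power_0_left)
  have c: "c ^ m = 1"
    using eigenvalue_root_of_unity assms by blast
  have "proj b w = scale (inverse (of_nat m) * (\<Sum>i<m. (inverse b * c) ^ i)) w"
    unfolding proj_def funpow_eigenvector[OF D_linear assms(1)]
    by (simp add: scale_sum_left[symmetric] power_mult_distrib)
  moreover have "(\<Sum>i<m. (inverse b * c) ^ i) = 0" if "b \<noteq> c"
  proof -
    have "(inverse b * c) ^ m = 1"
      using c assms(3) by (simp add: power_mult_distrib power_inverse)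
    moreover have "inverse b * c \<noteq> 1"
      using b that by (simp add: field_simps)
    ultimately show ?thesis
      by (simp add: geometric_sum)
  qed
  ultimately show ?thesis
    using b m_nonzero by auto
qed

text \<open>Fourier inversion: after exchanging the two sums, orthogonality leaves only the term
  \<open>i = 0\<close>.\<close>

lemma sum_proj: "(\<Sum>c | c ^ m = 1. proj c u) = u"
proof -
  define R where "R = {c :: 'k. c ^ m = 1}"
  have card_R: "card R = m"
    unfolding R_def by (rule card_roots_of_unity[OF m_nonzero])
  then have fin_R: "finite R"
    using m_pos by (metis card.infinite less_numeral_extra(3))
  \<comment> \<open>Fewer than \<open>m\<close> elements satisfy \<open>c^i = 1\<close>, so some
    root of unity \<open>z\<close> has \<open>z^i \<noteq> 1\<close>; multiplication by
    \<open>inverse z\<close> permutes \<open>R\<close> and scales the sum by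
    \<open>z^i\<close>.\<close>
  have R_inv: "(\<Sum>c\<in>R. inverse c ^ i) = 0" if i: "0 < i" "i < m" for i
  proof -
    define q :: "'k poly" where "q = monom 1 i - 1"
    have "degree q = i"
      using i unfolding q_def
      by (subst diff_conv_add_uminus, subst degree_add_eq_left) (auto simp: degree_monom_eq)
    then have q: "q \<noteq> 0" "card {c. poly q c = 0} \<le> i"
      using i poly_roots_degree[of q] by force+
    moreover have "{c. poly q c = 0} = {c. c ^ i = 1}"
      by (simp add: q_def poly_monom)
    ultimately have "\<not> R \<subseteq> {c. c ^ i = 1}"
      using q card_R i poly_roots_finite[of q] card_mono[of "{c. c ^ i = 1}" R] by force
    then obtain z :: 'k where z: "z ^ m = 1" "z ^ i \<noteq> 1"
      unfolding R_def by blast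
    have z0: "z \<noteq> 0"
      using z m_pos by (auto simp: power_0_left)
    have bij: "bij_betw ((*) (inverse z)) R R"
      using z z0 by (intro bij_betwI[where g = "(*) z"])
        (auto simp: R_def power_mult_distrib power_inverse mult.assoc[symmetric])
    have "(\<Sum>c\<in>R. inverse c ^ i) = (\<Sum>c\<in>R. inverse (inverse z * c) ^ i)"
      using sum.reindex_bij_betw[OF bij, of "\<lambda>c. inverse c ^ i"] by simp
    also have "\<dots> = z ^ i * (\<Sum>c\<in>R. inverse c ^ i)"
      by (simp add: power_mult_distrib sum_distrib_left)
    finally show ?thesis
      using z(2) by simp
  qed
  have "(\<Sum>c\<in>R. proj c u)
      = scale (inverse (of_nat m)) (\<Sum>c\<in>R. \<Sum>i<m. scale (inverse c ^ i) ((D ^^ i) u))"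
    unfolding proj_def by (rule scale_sum_right[symmetric])
  also have "(\<Sum>c\<in>R. \<Sum>i<m. scale (inverse c ^ i) ((D ^^ i) u))
      = (\<Sum>i<m. scale (\<Sum>c\<in>R. inverse c ^ i) ((D ^^ i) u))"
    unfolding scale_sum_left by (rule sum.swap)
  also have "(\<Sum>i<m. scale (\<Sum>c\<in>R. inverse c ^ i) ((D ^^ i) u))
      = (\<Sum>i<m. if i = 0 then scale (of_nat m) u else 0)"
    by (intro sum.cong) (auto simp: R_inv card_R)
  also have "\<dots> = scale (of_nat m) u"
    using m_pos by (simp add: sum.delta)
  finally show ?thesis
    using m_nonzero by (simp add: R_def)
qed

lemma exists_eigenvector_notin:
  assumes "subspace S" and "S \<noteq> UNIV"
  obtains w c where "w \<notin> S" and "D w = scale c w"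
proof -
  obtain u where "u \<notin> S"
    using assms(2) by auto
  then have "(\<Sum>c | c ^ m = 1. proj c u) \<notin> S"
    by (simp add: sum_proj)
  then obtain c where "c ^ m = 1" and "proj c u \<notin> S"
    using subspace_sum[OF assms(1), of "{c. c ^ m = 1}" "\<lambda>c. proj c u"] by auto
  then show ?thesis
    by (intro that[of "proj c u" c] D_proj)
qed

text \<open>The projection for the eigenvalue \<open>c n\<close> maps \<open>S\<close> into itself
  and kills the earlier \<open>w i\<close>, so it maps the span of these and \<open>B\<close> into
  \<open>S\<close>. It fixes \<open>w n\<close>, which is outside \<open>S\<close>.\<close>

lemma independent_eigenvectors:
  assumes S: "subspace S" "D ` S \<subseteq> S"
    and B: "independent B" "finite B" "B \<subseteq> S"
    and w: "\<And>i. i < n \<Longrightarrow> w i \<notin> S" "\<And>i. i < n \<Longrightarrow> D (w i) = scale (c i) (w i)"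
    and c: "inj_on c {..<n}"
  shows "independent (B \<union> w ` {..<n}) \<and> card (B \<union> w ` {..<n}) = card B + n"
  using w c
proof (induction n)
  case 0
  then show ?case
    using B by simp
next
  case (Suc n)
  have IH: "independent (B \<union> w ` {..<n}) \<and> card (B \<union> w ` {..<n}) = card B + n"
    using Suc by (simp add: inj_on_def)
  have w_nonzero: "w i \<noteq> 0" if "i < Suc n" for i
    using Suc.prems(1)[OF that] subspace_0[OF S(1)] by auto
  have root: "c n ^ m = 1"
    using eigenvalue_root_of_unity Suc.prems(2) w_nonzero by blast
  have "proj (c n) (w i) = 0" if "i < n" for i
    using proj_eigenvector[OF Suc.prems(2)[of i] w_nonzero[of i] root] that
      inj_on_eq_iff[OF Suc.prems(3), of n i] by simp
  then have eigenvectors_sub: "B \<union> w ` {..<n} \<subseteq> {u. proj (c n) u \<in> S}"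
    using B(3) proj_subspace[OF S] subspace_0[OF S(1)] by auto
  interpret proj: Vector_Spaces.linear scale scale "proj (c n)"
    by (rule linear_proj)
  from eigenvectors_sub have span_sub: "span (B \<union> w ` {..<n}) \<subseteq> {u. proj (c n) u \<in> S}"
    by (intro span_minimal proj.subspace_linear_preimage[OF S(1)])
  have "w n \<notin> span (B \<union> w ` {..<n})"
  proof
    assume "w n \<in> span (B \<union> w ` {..<n})"
    then have "proj (c n) (w n) \<in> S"
      using span_sub by auto
    then show False
      using proj_eigenvector[OF Suc.prems(2)[of n] w_nonzero[of n] root] Suc.prems(1)[of n] by simp
  qed
  moreover from this have "w n \<notin> B \<union> w ` {..<n}"
    using span_superset[of "B \<union> w ` {..<n}"] by (meson subsetD)
  moreover have "B \<union> w ` {..<Suc n} = insert (w n) (B \<union> w ` {..<n})"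
    by (auto simp: lessThan_Suc)
  ultimately show ?case
    using IH B(2) independent_insertI by (simp only: card_insert_disjoint finite_Un) simp
qed

end

section \<open>Shift operators\<close>

lemma commute_funpow:
  assumes "\<And>u. f (g u) = g (f u)"
  shows "f ((g ^^ n) u) = (g ^^ n) (f u)"
  using assms by (induction n) simp_all

text \<open>
  For \<open>C = {0}\<close> this is the Fitting null component of \<open>T\<close>; it is everything iff \<open>T\<close> is locally
  nilpotent.
\<close>
definition eventual_preimage :: "('a \<Rightarrow> 'a) \<Rightarrow> 'a set \<Rightarrow> 'a set"
  where "eventual_preimage T C = {u. \<exists>k. (T ^^ k) u \<in> C}"

lemma subset_eventual_preimage: "C \<subseteq> eventual_preimage T C"
  unfolding eventual_preimage_def using funpow_0 by (metis (mono_tags, lifting) mem_Collect_eq subsetI)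

lemma eventual_preimage_cancel:
  assumes "T u \<in> eventual_preimage T C"
  shows "u \<in> eventual_preimage T C"
proof -
  obtain k where "(T ^^ k) (T u) \<in> C"
    using assms by (auto simp: eventual_preimage_def)
  then have "(T ^^ Suc k) u \<in> C"
    by (simp add: funpow_swap1)
  then show ?thesis
    unfolding eventual_preimage_def by blast
qed

lemma funpow_eventual_preimage_cancel:
  assumes "(T ^^ n) u \<in> eventual_preimage T C"
  shows "u \<in> eventual_preimage T C"
  using assms by (induction n) (auto intro: eventual_preimage_cancel)

context vector_space
begin

lemma subspace_eventual_preimage:
  assumes T: "Vector_Spaces.linear scale scale T" and C: "subspace C" "T ` C \<subseteq> C"
  shows "subspace (eventual_preimage T C)"
proof (rule subspaceI)
  interpret T: Vector_Spaces.linear scale scale "T ^^ n" for n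
    by (rule linear_funpow[OF T])
  have T_C: "(T ^^ n) u \<in> C" if "u \<in> C" for n u
    using that C(2) by (induction n) auto
  show "0 \<in> eventual_preimage T C"
    using subspace_0[OF C(1)] by (rule subsetD[OF subset_eventual_preimage])
  show "u + v \<in> eventual_preimage T C"
    if u: "u \<in> eventual_preimage T C" and v: "v \<in> eventual_preimage T C" for u v
  proof -
    obtain k l where "(T ^^ k) u \<in> C" "(T ^^ l) v \<in> C"
      using u v by (auto simp: eventual_preimage_def)
    then have "(T ^^ l) ((T ^^ k) u) \<in> C" "(T ^^ k) ((T ^^ l) v) \<in> C"
      using T_C by auto
    then have "(T ^^ (k + l)) u \<in> C" "(T ^^ (k + l)) v \<in> C"
      by (metis add.commute comp_apply funpow_add)+
    then have "(T ^^ (k + l)) (u + v) \<in> C"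
      using C(1) by (simp add: T.add subspace_add)
    then show ?thesis
      unfolding eventual_preimage_def by blast
  qed
  show "scale c u \<in> eventual_preimage T C" if "u \<in> eventual_preimage T C" for c u
    using that C(1) T.scale subspace_scale unfolding eventual_preimage_def by force
qed

text \<open>If \<open>P v = F v\<close> and \<open>Q v = G v\<close> for polynomials
  \<open>F\<close>, \<open>G\<close> in \<open>Z\<close>, these commute with \<open>P\<close>,
  \<open>Q\<close> and each other, so
  \<open>P (Q v) = G (P v) = G (F v) = F (G v) = F (Q v) = Q (P v)\<close>.\<close>

lemma cyclic_commute:
  assumes P: "Vector_Spaces.linear scale scale P" "\<And>u. P (Z u) = Z (P u)"
    and Q: "Vector_Spaces.linear scale scale Q" "\<And>u. Q (Z u) = Z (Q u)"
    and Z: "Vector_Spaces.linear scale scale Z"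
    and v: "P v \<in> span (range (\<lambda>i. (Z ^^ i) v))" "Q v \<in> span (range (\<lambda>i. (Z ^^ i) v))"
  shows "P (Q v) = Q (P v)"
proof -
  interpret vector_space_pair scale scale ..
  \<comment> \<open>A stand-in for polynomials in \<open>Z\<close>: the argument uses only that they
    are linear and commute with whatever commutes with \<open>Z\<close>.\<close>
  define central where "central G \<longleftrightarrow> Vector_Spaces.linear scale scale G \<and>
    (\<forall>R. Vector_Spaces.linear scale scale R \<longrightarrow> (\<forall>u. R (Z u) = Z (R u)) \<longrightarrow> (\<forall>u. R (G u) = G (R u)))" for G
  have "\<exists>G. central G \<and> G v = w" if "w \<in> span (range (\<lambda>i. (Z ^^ i) v))" for w
    using that
  proof (induction rule: span_induct_alt)
    case base
    have "central (\<lambda>u. 0)"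
      unfolding central_def using linear_zero linear_0 by blast
    then show ?case
      by blast
  next
    case (step c x y)
    then obtain i G where x: "x = (Z ^^ i) v" and G: "central G" "G v = y"
      by blast
    have "Vector_Spaces.linear scale scale (\<lambda>u. scale c ((Z ^^ i) u) + G u)"
      using G(1) unfolding central_def
      by (intro linear_compose_add linear_compose_scale_right linear_funpow[OF Z]) simp
    moreover have "R (scale c ((Z ^^ i) u) + G u) = scale c ((Z ^^ i) (R u)) + G (R u)"
      if R: "Vector_Spaces.linear scale scale R" "\<forall>u. R (Z u) = Z (R u)" for R u
      using G(1) R commute_funpow[of R Z i u] unfolding central_def
      by (simp add: linear_add[OF R(1)] linear_scale[OF R(1)])
    ultimately have "central (\<lambda>u. scale c ((Z ^^ i) u) + G u)"
      unfolding central_def by blast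
    then show ?case
      using G(2) x by blast
  qed
  then obtain F G where F: "central F" "F v = P v" and G: "central G" "G v = Q v"
    using v by blast
  have F_Z: "F (Z u) = Z (F u)" for u
    using F(1) Z unfolding central_def by metis
  have "P (Q v) = G (P v)"
    using G P unfolding central_def by metis
  also have "\<dots> = F (G v)"
    using F F_Z G(1) unfolding central_def by metis
  also have "\<dots> = Q (P v)"
    using F G Q unfolding central_def by metis
  finally show ?thesis .
qed

end

section \<open>Fitting decomposition of an endomorphism\<close>

context finite_dimensional_vector_space
begin

lemma nilspace_uniform:
  assumes T: "Vector_Spaces.linear scale scale T"
  obtains K where "\<And>u. u \<in> eventual_preimage T {0} \<Longrightarrow> (T ^^ K) u = 0"
proof -
  interpret T: Vector_Spaces.linear scale scale "T ^^ n" for n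
    by (rule linear_funpow[OF T])
  obtain B where B: "B \<subseteq> eventual_preimage T {0}" "independent B"
      "eventual_preimage T {0} \<subseteq> span B"
    using basis_exists by metis
  have "\<forall>b\<in>B. \<exists>k. (T ^^ k) b = 0"
    using B(1) by (auto simp: eventual_preimage_def)
  then obtain k where k: "(T ^^ k b) b = 0" if "b \<in> B" for b
    by metis
  have "(T ^^ Max (k ` B)) b = 0" if b: "b \<in> B" for b
  proof -
    have "k b \<le> Max (k ` B)"
      using b finiteI_independent[OF B(2)] by simp
    then obtain j where "Max (k ` B) = j + k b"
      by (metis add.commute le_Suc_ex)
    then show ?thesis
      by (simp add: funpow_add k[OF b] T.zero)
  qed
  then have "(T ^^ Max (k ` B)) u = 0" if "u \<in> eventual_preimage T {0}" for u
    using that B(3) T.eq_0_on_span by blast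
  then show ?thesis
    by (rule that)
qed

text \<open>Since \<open>T^K\<close> kills the null component, it is injective on its own range and
  hence, by finite dimension, maps that range onto itself. So \<open>T^K u = T^K (T^K u')\<close>
  for some \<open>u'\<close>.\<close>

lemma fitting_decomposition:
  assumes T: "Vector_Spaces.linear scale scale T"
    and K: "\<And>u. u \<in> eventual_preimage T {0} \<Longrightarrow> (T ^^ K) u = 0"
  obtains u' where "u - (T ^^ K) u' \<in> eventual_preimage T {0}"
proof -
  define f where "f = T ^^ K"
  interpret f: Vector_Spaces.linear scale scale f
    unfolding f_def by (rule linear_funpow[OF T])
  interpret finite_dimensional_vector_space_pair_1 scale Basis scale ..
  have nil: "x \<in> eventual_preimage T {0}" if "f (f x) = 0" for x
  proof -
    have "(T ^^ (K + K)) x \<in> {0}"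
      using that by (simp add: f_def funpow_add)
    then show ?thesis
      unfolding eventual_preimage_def by blast
  qed
  have sub: "subspace (range f)"
    using f.subspace_image by simp
  have "inj_on f (range f)"
  proof (rule inj_onI)
    fix x y assume "x \<in> range f" "y \<in> range f" and eq: "f x = f y"
    then obtain z where z: "x - y = f z"
      by (metis f.diff rangeE)
    then have "f (f z) = 0"
      using eq by (metis f.diff right_minus_eq)
    then have "f z = 0"
      using K[OF nil] unfolding f_def by blast
    then show "x = y"
      using z by simp
  qed
  then have "inj_on f (span (range f))"
    unfolding span_eq_iff[THEN iffD2, OF sub] .
  then have "dim (f ` range f) = dim (range f)"
    by (intro dim_image_eq f.linear_axioms)
  then have "f ` range f = range f"
    using sub f.subspace_image by (intro subspace_dim_equal) auto
  then obtain u' where "f u = f (f u')"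
    by (metis (no_types, lifting) imageE rangeI)
  then have "f (f (u - f u')) = 0"
    by (simp add: f.diff)
  then show ?thesis
    using nil that[of u'] by (simp add: f_def)
qed

end

context finite_order_endomorphism
begin

lemma D_shift_funpow:
  assumes T: "Vector_Spaces.linear scale scale T" "\<And>u. D (T u) = T (D u) + scale s (T u)"
  shows "D ((T ^^ n) u) = (T ^^ n) (D u) + scale (of_nat n * s) ((T ^^ n) u)"
proof -
  interpret T: Vector_Spaces.linear scale scale T by fact
  show ?thesis
    by (induction n) (simp_all add: T(2) T.add T.scale scale_left_distrib distrib_right algebra_simps)
qed

lemma D_eventual_preimage:
  assumes T: "Vector_Spaces.linear scale scale T" "\<And>u. D (T u) = T (D u) + scale s (T u)"
    and C: "subspace C" "D ` C \<subseteq> C"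
  shows "D ` eventual_preimage T C \<subseteq> eventual_preimage T C"
proof
  fix w assume "w \<in> D ` eventual_preimage T C"
  then obtain u k where w: "w = D u" and k: "(T ^^ k) u \<in> C"
    by (auto simp: eventual_preimage_def)
  have "(T ^^ k) w = D ((T ^^ k) u) - scale (of_nat k * s) ((T ^^ k) u)"
    by (simp add: w D_shift_funpow[OF T])
  then have "(T ^^ k) w \<in> C"
    using k C by (auto intro!: subspace_diff subspace_scale)
  then show "w \<in> eventual_preimage T C"
    unfolding eventual_preimage_def by blast
qed

text \<open>The vectors \<open>T^i w\<close> have eigenvalues \<open>c + i s\<close>. The set
  \<open>B\<close> holds what was found inside \<open>S\<close> before, so that successive orbits
  can be accumulated.\<close>

lemma independent_shift_orbit:
  assumes T: "Vector_Spaces.linear scale scale T" "\<And>u. D (T u) = T (D u) + scale s (T u)"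
    and "s \<noteq> 0"
    and S: "subspace S" "D ` S \<subseteq> S" "\<And>u. T u \<in> S \<Longrightarrow> u \<in> S"
    and B: "independent B" "finite B" "B \<subseteq> S"
    and w: "w \<notin> S" "D w = scale c w"
  shows "independent (B \<union> (\<lambda>i. (T ^^ i) w) ` {..<CHAR('k)}) \<and>
    card (B \<union> (\<lambda>i. (T ^^ i) w) ` {..<CHAR('k)}) = card B + CHAR('k)"
proof (rule independent_eigenvectors[OF S(1,2) B])
  interpret T: Vector_Spaces.linear scale scale "T ^^ n" for n
    by (rule linear_funpow[OF T(1)])
  show "(T ^^ i) w \<notin> S" for i
    using w(1) S(3) by (induction i) auto
  show "D ((T ^^ i) w) = scale (c + of_nat i * s) ((T ^^ i) w)" for i
    by (simp add: D_shift_funpow[OF T] w(2) T.scale scale_left_distrib)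
  show "inj_on (\<lambda>i. c + of_nat i * s) {..<CHAR('k)}"
    using \<open>s \<noteq> 0\<close> by (auto intro!: inj_onI simp: of_nat_eq_iff_cong_CHAR cong_def)
qed

end

section \<open>Graded Heisenberg modules\<close>

locale graded_heisenberg_module =
  finite_order_endomorphism scale D m + finite_dimensional_vector_space scale Basis
  for scale :: "'k::alg_closed_field \<Rightarrow> 'v::ab_group_add \<Rightarrow> 'v"
    and D m Basis +
  fixes x y z :: "'v \<Rightarrow> 'v" and a b :: 'k
  assumes X_linear: "Vector_Spaces.linear scale scale x"
    and Y_linear: "Vector_Spaces.linear scale scale y"
    and Z_linear: "Vector_Spaces.linear scale scale z"
    and commutator: "x (y u) - y (x u) = z u"
    and XZ: "x (z u) = z (x u)"
    and YZ: "y (z u) = z (y u)"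
    and D_X: "D (x u) = x (D u) + scale a (x u)"
    and D_Y: "D (y u) = y (D u) + scale b (y u)"
    and D_Z: "D (z u) = z (D u) + scale (a + b) (z u)"
    and weights_nonzero: "a \<noteq> 0" "b \<noteq> 0" "a + b \<noteq> 0"
begin

sublocale x: Vector_Spaces.linear scale scale x
  by (rule X_linear)

sublocale y: Vector_Spaces.linear scale scale y
  by (rule Y_linear)

sublocale z: Vector_Spaces.linear scale scale z
  by (rule Z_linear)

text \<open>Lets the case where \<open>y\<close> is not nilpotent be read off from that of
  \<open>x\<close>; the sign of \<open>z\<close> keeps the commutator relation.\<close>

lemma swap_generators: "graded_heisenberg_module scale D m Basis y x (\<lambda>u. - z u) b a"
proof (intro graded_heisenberg_module.intro graded_heisenberg_module_axioms.intro)
  interpret vector_space_pair scale scale ..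
  show "Vector_Spaces.linear scale scale (\<lambda>u. - z u)"
    using Z_linear by (rule linear_compose_neg)
  show "y (x u) - x (y u) = - z u" for u
    by (simp add: commutator[symmetric])
qed (use XZ YZ D_X D_Y D_Z weights_nonzero X_linear Y_linear
      finite_order_endomorphism_axioms finite_dimensional_vector_space_axioms in
    \<open>simp_all add: add.commute D.neg x.neg y.neg\<close>)

text \<open>Two \<open>z\<close>-orbits of length p: that of \<open>v\<close>, taken modulo the null
  component, and that of \<open>w\<close>, taken modulo a subspace containing the first
  orbit.\<close>

lemma independent_if_z_not_nilpotent:
  assumes not_nil: "eventual_preimage z {0} \<noteq> UNIV"
  shows "\<exists>B. independent B \<and> card B = CHAR('k) + CHAR('k)"
proof -
  interpret x: Vector_Spaces.linear scale scale x by (rule X_linear)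
  interpret y: Vector_Spaces.linear scale scale y by (rule Y_linear)
  interpret z: Vector_Spaces.linear scale scale z by (rule Z_linear)
  interpret zn: Vector_Spaces.linear scale scale "z ^^ n" for n
    by (rule linear_funpow[OF Z_linear])
  let ?N = "eventual_preimage z {0}"
  have N: "subspace ?N" "D ` ?N \<subseteq> ?N"
    by (auto intro!: subspace_eventual_preimage D_eventual_preimage[OF Z_linear D_Z, THEN subsetD] Z_linear)
  obtain v c where v: "v \<notin> ?N" "D v = scale c v"
    using exists_eigenvector_notin[OF N(1) not_nil] .
  define C where "C = span (range (\<lambda>i. (z ^^ i) v))"
  have gen: "(z ^^ i) v \<in> C" for i
    unfolding C_def by (rule span_base) auto
  have C: "subspace C"
    unfolding C_def by simp
  have "range (\<lambda>i. (z ^^ i) v) \<subseteq> {u. z u \<in> C}"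
    using gen[of "Suc _"] by auto
  then have C_Z: "z ` C \<subseteq> C"
    using span_minimal[OF _ z.subspace_linear_preimage[OF C]] unfolding C_def by blast
  have "range (\<lambda>i. (z ^^ i) v) \<subseteq> {u. D u \<in> C}"
    using gen C by (auto simp: D_shift_funpow[OF Z_linear D_Z] v(2) zn.scale
        intro!: subspace_add subspace_scale)
  then have C_D: "D ` C \<subseteq> C"
    using span_minimal[OF _ D.subspace_linear_preimage[OF C]] unfolding C_def by blast
  let ?S = "eventual_preimage z C"
  have S: "subspace ?S" "D ` ?S \<subseteq> ?S"
    using subspace_eventual_preimage[OF Z_linear C C_Z]
      D_eventual_preimage[OF Z_linear D_Z C C_D] by auto
  \<comment> \<open>Otherwise \<open>x v\<close> and \<open>y v\<close> are, up to powers of \<open>z\<close>, polynomials in \<open>z\<close> applied to \<open>v\<close>, so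
    that \<open>x\<close> and \<open>y\<close> commute on \<open>v\<close>.\<close>
  have "?S \<noteq> UNIV"
  proof
    assume "?S = UNIV"
    then have "x v \<in> ?S" and "y v \<in> ?S"
      by auto
    then obtain k l where k: "(z ^^ k) (x v) \<in> C" and l: "(z ^^ l) (y v) \<in> C"
      by (auto simp: eventual_preimage_def)
    have XZn: "x ((z ^^ n) u) = (z ^^ n) (x u)" and YZn: "y ((z ^^ n) u) = (z ^^ n) (y u)"
      for n u
      using XZ YZ by (auto intro: commute_funpow)
    \<comment> \<open>The maps \<open>z^k x\<close> and \<open>z^l y\<close> commute with
      \<open>z\<close> and send \<open>v\<close> into its cyclic module.\<close>
    have "(z ^^ k) (x ((z ^^ l) (y v))) = (z ^^ l) (y ((z ^^ k) (x v)))"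
    proof (rule cyclic_commute[where Z = z])
      show "Vector_Spaces.linear scale scale (\<lambda>u. (z ^^ k) (x u))"
        using Vector_Spaces.linear_compose[OF X_linear zn.linear_axioms] by (simp add: o_def)
      show "Vector_Spaces.linear scale scale (\<lambda>u. (z ^^ l) (y u))"
        using Vector_Spaces.linear_compose[OF Y_linear zn.linear_axioms] by (simp add: o_def)
    qed (use k l Z_linear in \<open>auto simp: C_def XZ YZ funpow_swap1\<close>)
    moreover have "(z ^^ l) ((z ^^ k) u) = (z ^^ k) ((z ^^ l) u)" for u
      by (metis add.commute comp_apply funpow_add)
    ultimately have "(z ^^ k) ((z ^^ l) (x (y v) - y (x v))) = 0"
      by (simp add: zn.diff XZn YZn)
    then have "(z ^^ k) ((z ^^ l) (z v)) \<in> {0}"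
      by (simp add: commutator)
    then have "v \<in> ?N"
      by (meson eventual_preimage_cancel funpow_eventual_preimage_cancel subset_eventual_preimage subsetD)
    then show False
      using v by blast
  qed
  then obtain w d where w: "w \<notin> ?S" "D w = scale d w"
    using exists_eigenvector_notin[OF S(1)] by blast
  let ?B = "(\<lambda>i. (z ^^ i) v) ` {..<CHAR('k)}"
  have B: "independent ?B" "card ?B = CHAR('k)"
    using independent_shift_orbit[OF Z_linear D_Z weights_nonzero(3) N eventual_preimage_cancel
        independent_empty finite.emptyI empty_subsetI v]
    by simp_all
  have "?B \<subseteq> ?S"
    using gen by (auto intro: subsetD[OF subset_eventual_preimage])
  then have "independent (?B \<union> (\<lambda>i. (z ^^ i) w) ` {..<CHAR('k)}) \<and>
    card (?B \<union> (\<lambda>i. (z ^^ i) w) ` {..<CHAR('k)}) = card ?B + CHAR('k)"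
    by (intro independent_shift_orbit[OF Z_linear D_Z weights_nonzero(3) S eventual_preimage_cancel _ _ _ w])
      (use B in auto)
  then show ?thesis
    using B(2) by metis
qed

text \<open>The commutator of \<open>x^(k+1)\<close> and \<open>y\<close> is
  \<open>(k+1) x^k z\<close>, because \<open>z\<close> commutes with \<open>x\<close>.\<close>

lemma x_funpow_y:
  "(x ^^ Suc k) (y u) = y ((x ^^ Suc k) u) + scale (of_nat (Suc k)) ((x ^^ k) (z u))"
proof (induction k)
  case 0
  then show ?case
    by (simp add: commutator[symmetric])
next
  case (Suc k)
  have "(x ^^ Suc (Suc k)) (y u) = x ((x ^^ Suc k) (y u))"
    by simp
  also have "\<dots> = x (y ((x ^^ Suc k) u)) + scale (of_nat (Suc k)) ((x ^^ Suc k) (z u))"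
    unfolding Suc x.add x.scale by simp
  also have "x (y ((x ^^ Suc k) u)) = y ((x ^^ Suc (Suc k)) u) + z ((x ^^ Suc k) u)"
    by (simp add: commutator[symmetric])
  also have "z ((x ^^ Suc k) u) = (x ^^ Suc k) (z u)"
    by (rule commute_funpow) (rule XZ[symmetric])
  finally show ?case
    unfolding of_nat_Suc[of "Suc k"] scale_left_distrib by (simp add: add.assoc)
qed

lemma independent_if_x_not_nilpotent:
  assumes not_nil: "eventual_preimage x {0} \<noteq> UNIV"
    and z_nil: "eventual_preimage z {0} = UNIV"
    and z_nonzero: "z u\<^sub>0 \<noteq> 0"
    and char: "CHAR('k) \<ge> 3"
  shows "\<exists>B. independent B \<and> card B \<ge> CHAR('k) + 3"
proof -
  interpret xn: Vector_Spaces.linear scale scale "x ^^ n" for n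
    by (rule linear_funpow[OF X_linear])
  interpret zn: Vector_Spaces.linear scale scale "z ^^ n" for n
    by (rule linear_funpow[OF Z_linear])
  have zx: "z ((x ^^ n) u) = (x ^^ n) (z u)" and xz: "x ((z ^^ n) u) = (z ^^ n) (x u)" for n u
    using XZ by (auto intro!: commute_funpow)
  let ?N = "eventual_preimage x {0}"
  have N: "subspace ?N" "D ` ?N \<subseteq> ?N"
    using subspace_eventual_preimage[OF X_linear subspace_single_0]
      D_eventual_preimage[OF X_linear D_X subspace_single_0] by simp_all
  obtain v c where v: "v \<notin> ?N" "D v = scale c v"
    using exists_eigenvector_notin[OF N(1) not_nil] .
  obtain r where r: "(z ^^ r) u = 0" for u
    using nilspace_uniform[OF Z_linear] z_nil by auto
  show ?thesis
  proof (cases "range z \<subseteq> ?N")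
    \<comment> \<open>Two \<open>x\<close>-orbits of length p: one starts at \<open>w\<close> in the
      range of \<open>z\<close>, the other lies outside the eventual preimage of that range.
      Together they suffice, as \<open>2 p \<ge> p + 3\<close>.\<close>
    case False
    have "subspace {u. z u \<in> ?N}" and "{u. z u \<in> ?N} \<noteq> UNIV"
      using False z.subspace_linear_preimage[OF N(1)] by auto
    then obtain w' c' where w': "z w' \<notin> ?N" "D w' = scale c' w'"
      by (metis exists_eigenvector_notin mem_Collect_eq)
    define w where "w = z w'"
    have w: "w \<notin> ?N" "D w = scale (c' + (a + b)) w"
      using w' by (simp_all add: w_def D_Z z.scale scale_left_distrib)
    let ?B = "(\<lambda>i. (x ^^ i) w) ` {..<CHAR('k)}"
    have B: "independent ?B" "card ?B = CHAR('k)"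
      using independent_shift_orbit[OF X_linear D_X weights_nonzero(1) N eventual_preimage_cancel
          independent_empty finite.emptyI empty_subsetI w]
      by simp_all
    let ?S = "eventual_preimage x (range z)"
    have range_z: "subspace (range z)" "x ` range z \<subseteq> range z" "D ` range z \<subseteq> range z"
    proof -
      show "subspace (range z)"
        using z.subspace_image by simp
      show "x ` range z \<subseteq> range z"
        using XZ by auto
      have "D (z u) = z (D u + scale (a + b) u)" for u
        by (simp add: D_Z z.add z.scale)
      then show "D ` range z \<subseteq> range z"
        by auto
    qed
    have S: "subspace ?S" "D ` ?S \<subseteq> ?S"
      using subspace_eventual_preimage[OF X_linear range_z(1,2)]
        D_eventual_preimage[OF X_linear D_X range_z(1,3)] by simp_all
    have "?S \<noteq> UNIV"
    proof
      assume S_UNIV: "?S = UNIV"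
      \<comment> \<open>If powers of \<open>x\<close> carry every vector into the range of
        \<open>z\<close>, iteration carries it into the range of \<open>z^r\<close>, which is zero;
        then \<open>v\<close> would lie in the null component of \<open>x\<close>.\<close>
      have "\<exists>k u'. (x ^^ k) u = (z ^^ j) u'" for j u
      proof (induction j)
        case 0
        show ?case
          by (rule exI[of _ 0]) simp
      next
        case (Suc j)
        then obtain k u' where k: "(x ^^ k) u = (z ^^ j) u'"
          by blast
        have "u' \<in> ?S"
          using S_UNIV by simp
        then obtain l u'' where l: "(x ^^ l) u' = z u''"
          unfolding eventual_preimage_def by blast
        have "(x ^^ (l + k)) u = (x ^^ l) ((z ^^ j) u')"
          by (simp add: funpow_add k)
        also have "\<dots> = (z ^^ j) ((x ^^ l) u')"
          by (rule commute_funpow[symmetric]) (rule xz[symmetric])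
        finally have "(x ^^ (l + k)) u = (z ^^ Suc j) u''"
          by (simp add: l funpow_swap1)
        then show ?case
          by blast
      qed
      from this[of v r] obtain k where "(x ^^ k) v = 0"
        using r by auto
      then show False
        using v(1) by (auto simp: eventual_preimage_def)
    qed
    then obtain w'' d where w'': "w'' \<notin> ?S" "D w'' = scale d w''"
      using exists_eigenvector_notin[OF S(1)] by blast
    have "(x ^^ i) w \<in> range z" for i
      unfolding w_def zx[symmetric] by blast
    then have B_S: "?B \<subseteq> ?S"
      by (auto intro: subsetD[OF subset_eventual_preimage])
    show ?thesis
      using independent_shift_orbit[OF X_linear D_X weights_nonzero(1) S eventual_preimage_cancel
          B(1) _ B_S w''] B(2) char
      by (intro exI[of _ "?B \<union> (\<lambda>i. (x ^^ i) w'') ` {..<CHAR('k)}"]) simp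
  next
    case True
    obtain K where K: "(x ^^ K) u = 0" if "u \<in> ?N" for u
      using nilspace_uniform[OF X_linear] by blast
    obtain u' where u': "u\<^sub>0 - (x ^^ K) u' \<in> ?N"
      using fitting_decomposition[OF X_linear K] by blast
    define n where "n = u\<^sub>0 - (x ^^ K) u'"
    have n: "n \<in> ?N"
      using u' by (simp add: n_def)
    \<comment> \<open>As \<open>z\<close> commutes with \<open>x^K\<close> and maps into the null
      component, it kills the other Fitting part, so \<open>z\<close> is nonzero already on
      \<open>n\<close>.\<close>
    have "z ((x ^^ K) u') = 0"
      unfolding zx using True by (intro K) auto
    then have zn: "z n \<noteq> 0"
      using z_nonzero by (simp add: n_def z.diff)
    have x_N: "x u \<in> ?N" if "u \<in> ?N" for u
    proof -
      have "(x ^^ K) (x u) = x ((x ^^ K) u)"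
        by (rule funpow_swap1[symmetric])
      then have "(x ^^ K) (x u) \<in> {0}"
        using K[OF that] by simp
      then show ?thesis
        unfolding eventual_preimage_def by blast
    qed
    have y_N: "y u \<in> ?N" if "u \<in> ?N" for u
    proof -
      \<comment> \<open>One more power than \<open>K\<close> is needed: the commutator with
        \<open>y\<close> leaves a term with \<open>x^K\<close>.\<close>
      have "(x ^^ Suc K) (y u) = 0"
        unfolding x_funpow_y zx[symmetric] using K[OF that] by simp
      then show ?thesis
        unfolding eventual_preimage_def by blast
    qed
    \<comment> \<open>The null component of \<open>x\<close> is a submodule on which \<open>z\<close> does not vanish, hence of dimension at
      least 3: otherwise \<open>n\<close> would be a cyclic vector for \<open>z\<close>.\<close>
    have n_indep: "n \<notin> span {z n}"
    proof
      assume "n \<in> span {z n}"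
      then obtain \<beta> where \<beta>: "n = scale \<beta> (z n)"
        by (auto simp: span_singleton)
      \<comment> \<open>Being a multiple of \<open>z n\<close>, the vector \<open>n\<close> is
        divisible by every power of \<open>z\<close>, including \<open>z^r = 0\<close>.\<close>
      have "n \<in> range (z ^^ i)" for i
      proof (induction i)
        case (Suc i)
        then obtain u where "n = (z ^^ i) u"
          by blast
        then have "(z ^^ Suc i) (scale \<beta> u) = scale \<beta> (z n)"
          by (simp only: zn.scale funpow.simps(2) comp_apply z.scale)
        then have "n = (z ^^ Suc i) (scale \<beta> u)"
          using \<beta> by simp
        then show ?case
          by blast
      qed simp
      from this[of r] have "n = 0"
        using r by auto
      then show False
        using zn by simp
    qed
    have "\<not> ?N \<subseteq> span {n, z n}"
    proof
      assume N_sub: "?N \<subseteq> span {n, z n}"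
      have "{n, z n} \<subseteq> range (\<lambda>i. (z ^^ i) n)"
        using rangeI[of "\<lambda>i. (z ^^ i) n" 0] rangeI[of "\<lambda>i. (z ^^ i) n" 1] by simp
      then have "?N \<subseteq> span (range (\<lambda>i. (z ^^ i) n))"
        using N_sub span_mono by blast
      then have "x (y n) = y (x n)"
        using x_N[OF n] y_N[OF n]
        by (intro cyclic_commute[OF X_linear XZ Y_linear YZ Z_linear]) auto
      then show False
        using zn commutator[of n] by simp
    qed
    then obtain l where l: "l \<in> ?N" "l \<notin> span {n, z n}"
      by blast
    let ?B = "{l, n, z n}"
    have B: "independent ?B" "?B \<subseteq> ?N"
      using independent_insertI[OF l(2) independent_insertI[OF n_indep]] l(1) n zn True by auto
    have "l \<notin> {n, z n}" "n \<noteq> z n"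
      using l(2) n_indep span_superset[of "{n, z n}"] span_superset[of "{z n}"] by auto
    then have "card ?B = 3"
      by simp
    then show ?thesis
      using independent_shift_orbit[OF X_linear D_X weights_nonzero(1) N eventual_preimage_cancel
          B(1) _ B(2) v]
      by (intro exI[of _ "?B \<union> (\<lambda>i. (x ^^ i) v) ` {..<CHAR('k)}"]) simp
  qed
qed

theorem dim_ge:
  assumes "eventual_preimage x {0} \<noteq> UNIV \<or> eventual_preimage y {0} \<noteq> UNIV \<or>
      eventual_preimage z {0} \<noteq> UNIV"
    and "z u \<noteq> 0"
    and "CHAR('k) \<ge> 3"
  shows "dim UNIV \<ge> CHAR('k) + 3"
proof -
  have "\<exists>B. independent B \<and> card B \<ge> CHAR('k) + 3"
  proof (cases "eventual_preimage z {0} = UNIV")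
    case False
    then show ?thesis
      using independent_if_z_not_nilpotent assms(3) by fastforce
  next
    case True
    interpret swapped: graded_heisenberg_module scale D m Basis y x "\<lambda>u. - z u" b a
      by (rule swap_generators)
    have "eventual_preimage (\<lambda>u. - z u) {0} = UNIV"
    proof -
      have "((\<lambda>u. - z u) ^^ n) v = 0" if "(z ^^ n) v = 0" for n v
      proof -
        have "((\<lambda>u. - z u) ^^ n) v = scale ((- 1) ^ n) ((z ^^ n) v)"
          by (induction n) (simp_all add: z.scale)
        then show ?thesis
          using that by simp
      qed
      then show ?thesis
        using True unfolding eventual_preimage_def by blast
    qed
    then show ?thesis
      using assms True independent_if_x_not_nilpotent[of u]
        swapped.independent_if_x_not_nilpotent[of u] by auto
  qed
  then show ?thesis
    using independent_card_le_dim[OF subset_UNIV] le_trans by blast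
qed

end

section \<open>Derivations and semidirect sums\<close>

context vector_space
begin

text \<open>Pascal's rule; \<open>c k l\<close> is to be read as the bracket of the
  \<open>k\<close>-th and \<open>l\<close>-th iterated derivatives of two elements.\<close>

lemma leibniz_funpow:
  assumes f: "Vector_Spaces.linear scale scale f"
    and step: "\<And>k l. f (c k l) = c (Suc k) l + c k (Suc l)"
  shows "(f ^^ n) (c k l) = (\<Sum>j\<le>n. scale (of_nat (n choose j)) (c (k + j) (l + (n - j))))"
proof (induction n arbitrary: k l)
  interpret f: Vector_Spaces.linear scale scale f by fact
  case 0
  show ?case
    by simp
next
  interpret fn: Vector_Spaces.linear scale scale "f ^^ n" for n
    by (rule linear_funpow[OF f])
  case (Suc n)
  let ?t = "\<lambda>j. c (k + j) (l + (Suc n - j))"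
  have "(f ^^ Suc n) (c k l) = (f ^^ n) (c (Suc k) l) + (f ^^ n) (c k (Suc l))"
    by (simp only: funpow_Suc_right comp_apply step fn.add)
  also have "(f ^^ n) (c (Suc k) l) = (\<Sum>j\<le>n. scale (of_nat (n choose j)) (?t (Suc j)))"
    unfolding Suc by simp
  also have "(f ^^ n) (c k (Suc l)) = (\<Sum>j\<le>n. scale (of_nat (n choose j)) (?t j))"
    unfolding Suc by (intro sum.cong) (auto simp: Suc_diff_le)
  also have "\<dots> = (\<Sum>j\<le>Suc n. scale (of_nat (n choose j)) (?t j))"
    by (simp add: binomial_eq_0)
  also have "\<dots> = ?t 0 + (\<Sum>j\<le>n. scale (of_nat (n choose Suc j)) (?t (Suc j)))"
    by (simp only: sum.atMost_Suc_shift) simp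
  also have "(\<Sum>j\<le>n. scale (of_nat (n choose j)) (?t (Suc j))) +
      (?t 0 + (\<Sum>j\<le>n. scale (of_nat (n choose Suc j)) (?t (Suc j)))) =
      ?t 0 + (\<Sum>j\<le>n. scale (of_nat (Suc n choose Suc j)) (?t (Suc j)))"
    by (simp add: scale_left_distrib sum.distrib del: diff_Suc_Suc)
  also have "\<dots> = (\<Sum>j\<le>Suc n. scale (of_nat (Suc n choose j)) (?t j))"
    by (simp only: sum.atMost_Suc_shift) simp
  finally show ?case .
qed

end

context lie_algebra
begin

lemma bracket_zero_left [simp]: "bracket 0 x = 0"
  using bracket_add_left[of 0 0 x] by simp

lemma bracket_zero_right [simp]: "bracket x 0 = 0"
  using bracket_add_right[of x 0 0] by simp

lemma bracket_swap: "bracket y x = - bracket x y"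
proof -
  have "bracket (x + y) (x + y) = bracket x y + bracket y x"
    unfolding bracket_add_left bracket_add_right by (simp add: bracket_self)
  then show ?thesis
    by (simp add: bracket_self eq_neg_iff_add_eq_0 add.commute)
qed

text \<open>In characteristic p the inner binomial coefficients of the Leibniz formula
  vanish.\<close>

lemma derivation_funpow_CHAR:
  assumes "derivation d" and p: "prime CHAR('k)"
  shows "derivation (d ^^ CHAR('k))"
  unfolding derivation_def
proof (intro conjI allI)
  have d: "Vector_Spaces.linear scale scale d"
    and leibniz: "d (bracket x y) = bracket (d x) y + bracket x (d y)" for x y
    using assms(1) by (auto simp: derivation_def)
  show "Vector_Spaces.linear scale scale (d ^^ CHAR('k))"
    by (rule linear_funpow[OF d])
  fix x y
  let ?p = "CHAR('k)"
  have "of_nat (?p choose j) = (0::'k)" if "0 < j" "j < ?p" for j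
    using dvd_choose_prime[of j ?p] p that by (simp add: of_nat_eq_0_iff_char_dvd)
  moreover have "?p > 0"
    using p by (rule prime_gt_0_nat)
  ultimately have eq: "scale (of_nat (?p choose j)) (bracket ((d ^^ j) x) ((d ^^ (?p - j)) y)) =
      (if j = 0 then bracket x ((d ^^ ?p) y) else 0) + (if j = ?p then bracket ((d ^^ ?p) x) y else 0)"
    if "j \<le> ?p" for j
    using that by (cases "j = 0"; cases "j = ?p") auto
  have "(d ^^ ?p) (bracket ((d ^^ 0) x) ((d ^^ 0) y)) =
      (\<Sum>j\<le>?p. scale (of_nat (?p choose j)) (bracket ((d ^^ (0 + j)) x) ((d ^^ (0 + (?p - j))) y)))"
    by (rule leibniz_funpow[OF d, of "\<lambda>k l. bracket ((d ^^ k) x) ((d ^^ l) y)"]) (simp add: leibniz)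
  also have "\<dots> = bracket x ((d ^^ ?p) y) + bracket ((d ^^ ?p) x) y"
    by (simp add: eq sum.distrib)
  finally show "(d ^^ ?p) (bracket x y) = bracket ((d ^^ ?p) x) y + bracket x ((d ^^ ?p) y)"
    by (simp add: add.commute)
qed

lemma derivation_funpow_CHAR_power:
  assumes "derivation d" and p: "prime CHAR('k)"
  shows "derivation (d ^^ (CHAR('k) ^ k))"
proof (induction k)
  case (Suc k)
  have "d ^^ (CHAR('k) ^ Suc k) = (d ^^ (CHAR('k) ^ k)) ^^ CHAR('k)"
    by (simp add: funpow_mult mult.commute)
  then show ?case
    using derivation_funpow_CHAR[OF Suc p] by simp
qed (use assms in simp)

lemma subspace_centralizer: "subspace {v. bracket u v = 0}"
  by (rule subspaceI) (auto simp: bracket_add_right bracket_scale_right)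

lemma subspace_center: "subspace {u. \<forall>v. bracket u v = 0}"
  by (rule subspaceI) (auto simp: bracket_add_left bracket_scale_left)

end

section \<open>Heisenberg algebras: two-step nilpotency and generating pairs\<close>

context heisenberg_algebra
begin

lemma bracket_nonzero: "\<exists>u v. bracket u v \<noteq> 0"
  using heisenberg_basis dependent_zero by (metis insertCI)

lemma bracket_bracket: "bracket h (bracket u v) = 0"
proof -
  obtain x y z where span: "span {x, y, z} = UNIV"
    and brackets: "bracket x y = z" "bracket x z = 0" "bracket y z = 0"
    using heisenberg_basis by blast
  have flip: "bracket y x = - z" "bracket z x = 0" "bracket z y = 0"
    using brackets by (simp_all add: bracket_swap[of y x] bracket_swap[of z x] bracket_swap[of z y])
  have "UNIV \<subseteq> {w. bracket z w = 0}"
    unfolding span[symmetric] using flip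
    by (intro span_minimal subspace_centralizer) (auto simp: bracket_self)
  from subsetD[OF this UNIV_I] have "bracket z w = 0" for w
    by simp
  then have z_central: "bracket w z = 0" for w
    using bracket_swap[of w z] by simp
  have sub: "subspace {w. bracket u w \<in> span {z}}" "subspace {w. bracket w v \<in> span {z}}" for u v
    by (auto intro!: subspaceI simp: bracket_add_right bracket_scale_right bracket_add_left
        bracket_scale_left span_zero span_add span_scale)
  have basis: "bracket u v \<in> span {z}" if "u \<in> {x, y, z}" "v \<in> {x, y, z}" for u v
    using that brackets flip by (auto simp: bracket_self span_zero span_neg span_base)
  have left: "bracket u w \<in> span {z}" if "u \<in> {x, y, z}" for u w
    using span_minimal[OF _ sub(1)[of u], of "{x, y, z}"] basis[OF that] unfolding span by auto
  have "bracket u v \<in> span {z}"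
    using span_minimal[OF _ sub(2)[of v], of "{x, y, z}"] left unfolding span by auto
  then obtain c where "bracket u v = scale c z"
    by (auto simp: span_singleton)
  then show ?thesis
    by (simp add: bracket_scale_right z_central)
qed

text \<open>Allows eigenvectors to replace the given basis. The bracket is central, so a linear
  dependence among the three vectors would make \<open>x\<close> and \<open>y\<close>
  commute.\<close>

lemma span_noncommuting:
  assumes "bracket x y \<noteq> 0"
  shows "span {x, y, bracket x y} = UNIV"
proof -
  obtain x\<^sub>0 y\<^sub>0 z\<^sub>0 where basis: "distinct [x\<^sub>0, y\<^sub>0, z\<^sub>0]" "independent {x\<^sub>0, y\<^sub>0, z\<^sub>0}"
    "span {x\<^sub>0, y\<^sub>0, z\<^sub>0} = UNIV"
    using heisenberg_basis by blast
  interpret finite_dimensional_vector_space scale "{x\<^sub>0, y\<^sub>0, z\<^sub>0}"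
    by unfold_locales (use basis in auto)
  have dim: "dim UNIV = 3"
    using basis(1) by simp
  have "y \<notin> span {bracket x y}"
    using assms by (auto simp: span_singleton bracket_scale_right bracket_bracket)
      (metis bracket_scale_right bracket_bracket scale_zero_right)
  moreover have "x \<notin> span {y, bracket x y}"
  proof
    assume "x \<in> span {y, bracket x y}"
    then have "x \<in> {w. bracket y w = 0}"
      using span_minimal[OF _ subspace_centralizer[of y], of "{y, bracket x y}"]
      by (auto simp: bracket_self bracket_bracket)
    then show False
      using assms bracket_swap[of y x] by simp
  qed
  ultimately have "independent {x, y, bracket x y}" and "distinct [x, y, bracket x y]"
    using assms span_base[of y "{y, bracket x y}"] span_base[of "bracket x y" "{y, bracket x y}"]
      span_base[of "bracket x y" "{bracket x y}"]
    using independent_insertI[of x "{y, bracket x y}"] independent_insertI[of y "{bracket x y}"]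
    by auto
  then have "UNIV \<subseteq> span {x, y, bracket x y}"
    using card_ge_dim_independent[of "{x, y, bracket x y}" UNIV] dim by simp
  then show ?thesis
    by blast
qed

end

section \<open>Nilpotency and derivations of semidirect sums\<close>

context lie_representation
begin

sublocale P: vector_space_prod scale scaleV
  by unfold_locales

sublocale S: lie_algebra P.scale "semidirect_bracket bracket rep"
  by (rule lie_algebra_semidirect)

sublocale rep: Vector_Spaces.linear scaleV scaleV "rep x" for x
  by (rule rep_linear)

lemma rep_zero [simp]: "rep 0 v = 0"
  using rep_add[of 0 0 v] by simp

text \<open>Two steps of the lower central series exhaust the first component: it becomes central,
  then zero. From there the series descends along \<open>M\<close>, hence the index shift by
  2.\<close>

lemma semidirect_nilpotent:
  assumes two_step: "\<And>h u v. bracket h (bracket u v) = 0"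
    and M: "\<And>i. V.subspace (M i)" "\<And>h w i. w \<in> M i \<Longrightarrow> rep h w \<in> M (Suc i)"
    and M_0: "M 0 = UNIV" and M_n: "M n = {0}"
  shows "S.nilpotent"
proof -
  define C where "C = {u. \<forall>v. bracket u v = 0}"
  have C: "bracket v u = 0" if "u \<in> C" for u v
    using that L.bracket_swap[of u v] by (simp add: C_def)
  have C_bracket: "bracket u v \<in> C" for u v
    using L.bracket_swap[of "bracket u v"] by (simp add: C_def two_step)
  have "S.lower_central_series (Suc 0) \<subseteq> C \<times> UNIV"
    unfolding S.lower_central_series.simps
    by (intro P.p.span_minimal P.subspace_Times V.subspace_UNIV)
      (use C_bracket in \<open>auto simp: C_def L.subspace_center\<close>)
  then have "S.lower_central_series (Suc (Suc 0)) \<subseteq> {0} \<times> M 0"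
    unfolding S.lower_central_series.simps(2)[of "Suc 0"] M_0
    by (intro P.p.span_minimal P.subspace_Times V.subspace_UNIV L.subspace_single_0) (auto simp: C)
  then have "S.lower_central_series (Suc (Suc i)) \<subseteq> {0} \<times> M i" for i
  proof (induction i)
    case (Suc i)
    from Suc.IH[OF Suc.prems] show ?case
      unfolding S.lower_central_series.simps(2)[of "Suc (Suc i)"]
      by (intro P.p.span_minimal P.subspace_Times M(1) L.subspace_single_0) (auto intro!: M(2))
  qed
  from this[of n] have "S.lower_central_series (Suc (Suc n)) \<subseteq> {0}"
    by (auto simp: M_n zero_prod_def)
  moreover have "0 \<in> S.lower_central_series (Suc (Suc n))"
    by (simp add: P.p.span_zero)
  ultimately have "S.lower_central_series (Suc (Suc n)) = {0}"
    by blast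
  then show ?thesis
    unfolding S.nilpotent_def by blast
qed

text \<open>By invariance of the ideal, \<open>E\<close> is block triangular; \<open>d\<close> acts
  on the quotient and \<open>D\<close> on the ideal. The off-diagonal block drops out of the last
  identity because the ideal is abelian.\<close>

lemma semidirect_derivation_components:
  assumes E: "S.derivation E" and inv: "E ` ({0} \<times> UNIV) \<subseteq> {0} \<times> UNIV"
  obtains d D where "Vector_Spaces.linear scale scale d" "Vector_Spaces.linear scaleV scaleV D"
    "\<And>h v. fst (E (h, v)) = d h" "\<And>v. E (0, v) = (0, D v)"
    "\<And>u v. d (bracket u v) = bracket (d u) v + bracket u (d v)"
    "\<And>h v. D (rep h v) = rep (d h) v + rep h (D v)"
proof -
  interpret E: Vector_Spaces.linear P.scale P.scale E
    using E by (simp add: S.derivation_def)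
  have leibniz: "E (semidirect_bracket bracket rep u v) =
      semidirect_bracket bracket rep (E u) v + semidirect_bracket bracket rep u (E v)" for u v
    using E unfolding S.derivation_def by blast
  define d where "d h = fst (E (h, 0))" for h
  define D where "D v = snd (E (0, v))" for v
  have E_D: "E (0, v) = (0, D v)" for v
    using inv by (force simp: D_def prod_eq_iff)
  have fst_E: "fst (E (h, v)) = d h" for h v
    using E.add[of "(h, 0)" "(0, v)"] by (simp add: E_D d_def)
  have E_d: "\<exists>w. E (h, v) = (d h, w)" for h v
    by (metis fst_E prod.collapse)
  show ?thesis
  proof (rule that)
    show "Vector_Spaces.linear scale scale d"
    proof unfold_locales
      show "d (u + v) = d u + d v" for u v
        using E.add[of "(u, 0)" "(v, 0)"] by (simp add: d_def)
      show "d (scale c u) = scale c (d u)" for c u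
        using E.scale[of c "(u, 0)"] by (simp add: d_def P.scale_def)
    qed
    show "Vector_Spaces.linear scaleV scaleV D"
    proof unfold_locales
      show "D (u + v) = D u + D v" for u v
        using E.add[of "(0, u)" "(0, v)"] by (simp add: D_def)
      show "D (scaleV c u) = scaleV c (D u)" for c u
        using E.scale[of c "(0, u)"] by (simp add: D_def P.scale_def)
    qed
    show "d (bracket u v) = bracket (d u) v + bracket u (d v)" for u v
    proof -
      have "fst (E (bracket u v, 0)) = fst (semidirect_bracket bracket rep (E (u, 0)) (v, 0)) +
          fst (semidirect_bracket bracket rep (u, 0) (E (v, 0)))"
        using leibniz[of "(u, 0)" "(v, 0)"] by (simp add: rep.zero)
      then show ?thesis
        using E_d[of u 0] E_d[of v 0] by (auto simp: fst_E)
    qed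
    show "D (rep h v) = rep (d h) v + rep h (D v)" for h v
    proof -
      have "E (0, rep h v) = semidirect_bracket bracket rep (E (h, 0)) (0, v) +
          semidirect_bracket bracket rep (h, 0) (E (0, v))"
        using leibniz[of "(h, 0)" "(0, v)"] by simp
      then show ?thesis
        using E_d[of h 0] by (auto simp: E_D)
    qed
  qed (rule fst_E E_D)+
qed

end

section \<open>Nilpotent actions of the Heisenberg algebra\<close>

context graded_heisenberg_module
begin

text \<open>
  Giving \<open>z\<close> degree 2 makes the straightening rule \<open>y x = x y - z\<close> compatible with degrees.
\<close>
definition filtration :: "nat \<Rightarrow> 'v set" where
  "filtration n = span {(z ^^ i) ((x ^^ j) ((y ^^ k) v)) | i j k v. 2 * i + j + k \<ge> n}"

lemma filtration_base: "2 * i + j + k \<ge> n \<Longrightarrow> (z ^^ i) ((x ^^ j) ((y ^^ k) v)) \<in> filtration n"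
  unfolding filtration_def by (rule span_base) blast

lemma subspace_filtration: "subspace (filtration n)"
  unfolding filtration_def by (rule subspace_span)

lemma filtration_0: "filtration 0 = UNIV"
proof -
  have "v \<in> filtration 0" for v
    using filtration_base[of 0 0 0 0 v] by simp
  then show ?thesis
    by blast
qed

lemma filtration_step:
  assumes "w \<in> filtration n"
  shows "x w \<in> filtration (Suc n)" and "y w \<in> filtration (Suc n)" and "z w \<in> filtration (Suc n)"
proof -
  interpret zn: Vector_Spaces.linear scale scale "z ^^ l" for l
    by (rule linear_funpow[OF Z_linear])
  have xz: "x ((z ^^ i) u) = (z ^^ i) (x u)" and yz: "y ((z ^^ i) u) = (z ^^ i) (y u)"
    and zx: "z ((x ^^ i) u) = (x ^^ i) (z u)" for i u
    using XZ YZ by (auto intro!: commute_funpow)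
  have x_gen: "x ((z ^^ i) ((x ^^ j) ((y ^^ k) v))) \<in> filtration (Suc n)"
    if "2 * i + j + k \<ge> n" for i j k v
    using filtration_base[of "Suc n" i "Suc j" k v] that by (simp add: xz)
  have z_gen: "z ((z ^^ i) ((x ^^ j) ((y ^^ k) v))) \<in> filtration (Suc n)"
    if "2 * i + j + k \<ge> n" for i j k v
    using filtration_base[of "Suc n" "Suc i" j k v] that by simp
  have y_gen: "y ((z ^^ i) ((x ^^ j) ((y ^^ k) v))) \<in> filtration (Suc n)"
    if ijk: "2 * i + j + k \<ge> n" for i j k v
  proof (cases j)
    case 0
    then show ?thesis
      using filtration_base[of "Suc n" i 0 "Suc k" v] ijk by (simp add: yz)
  next
    case (Suc l)
    \<comment> \<open>Straightening trades one \<open>x\<close> and the new \<open>y\<close> for one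
      \<open>z\<close>, which preserves the degree.\<close>
    have "y ((x ^^ j) u) = (x ^^ j) (y u) - scale (of_nat j) ((x ^^ l) (z u))" for u
      unfolding Suc x_funpow_y by simp
    then have "y ((z ^^ i) ((x ^^ j) ((y ^^ k) v))) = (z ^^ i) ((x ^^ j) ((y ^^ Suc k) v)) -
        scale (of_nat j) ((z ^^ Suc i) ((x ^^ l) ((y ^^ k) v)))"
      by (simp add: yz zn.diff zn.scale funpow_swap1 zx)
    also have "\<dots> \<in> filtration (Suc n)"
      using ijk Suc
      by (intro subspace_diff subspace_scale subspace_filtration filtration_base) auto
    finally show ?thesis .
  qed
  have "filtration n \<subseteq> {w. x w \<in> filtration (Suc n)}"
    unfolding filtration_def[of n]
    by (intro span_minimal x.subspace_linear_preimage subspace_filtration) (use x_gen in blast)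
  from subsetD[OF this assms] show "x w \<in> filtration (Suc n)"
    by simp
  have "filtration n \<subseteq> {w. y w \<in> filtration (Suc n)}"
    unfolding filtration_def[of n]
    by (intro span_minimal y.subspace_linear_preimage subspace_filtration) (use y_gen in blast)
  from subsetD[OF this assms] show "y w \<in> filtration (Suc n)"
    by simp
  have "filtration n \<subseteq> {w. z w \<in> filtration (Suc n)}"
    unfolding filtration_def[of n]
    by (intro span_minimal z.subspace_linear_preimage subspace_filtration) (use z_gen in blast)
  from subsetD[OF this assms] show "z w \<in> filtration (Suc n)"
    by simp
qed

text \<open>In a monomial of large degree at least one exponent reaches the nilpotency index of its
  operator.\<close>

lemma filtration_trivial:
  assumes "eventual_preimage x {0} = UNIV" "eventual_preimage y {0} = UNIV"
    "eventual_preimage z {0} = UNIV"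
  shows "\<exists>n. filtration n = {0}"
proof -
  interpret xn: Vector_Spaces.linear scale scale "x ^^ n" for n
    by (rule linear_funpow[OF X_linear])
  interpret yn: Vector_Spaces.linear scale scale "y ^^ n" for n
    by (rule linear_funpow[OF Y_linear])
  interpret zn: Vector_Spaces.linear scale scale "z ^^ n" for n
    by (rule linear_funpow[OF Z_linear])
  obtain K\<^sub>x K\<^sub>y K\<^sub>z where K: "(x ^^ K\<^sub>x) u = 0" "(y ^^ K\<^sub>y) u = 0" "(z ^^ K\<^sub>z) u = 0" for u
    using nilspace_uniform[OF X_linear] nilspace_uniform[OF Y_linear] nilspace_uniform[OF Z_linear]
      assms by (metis UNIV_I)
  have x0: "(x ^^ j) u = 0" if "j \<ge> K\<^sub>x" for j u
    using that K(1) by (metis comp_apply funpow_add le_add_diff_inverse)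
  have y0: "(y ^^ j) u = 0" if "j \<ge> K\<^sub>y" for j u
    using that K(2) by (metis comp_apply funpow_add le_add_diff_inverse)
  have z0: "(z ^^ j) u = 0" if "j \<ge> K\<^sub>z" for j u
    using that K(3) by (metis comp_apply funpow_add le_add_diff_inverse)
  have "(z ^^ i) ((x ^^ j) ((y ^^ k) v)) = 0" if "2 * i + j + k \<ge> 2 * K\<^sub>z + K\<^sub>x + K\<^sub>y" for i j k v
  proof -
    have "i \<ge> K\<^sub>z \<or> j \<ge> K\<^sub>x \<or> k \<ge> K\<^sub>y"
      using that by linarith
    then show ?thesis
      by (auto simp: x0 y0 z0 xn.zero zn.zero)
  qed
  then have "filtration (2 * K\<^sub>z + K\<^sub>x + K\<^sub>y) \<subseteq> {0}"
    unfolding filtration_def by (intro span_minimal subspace_single_0) blast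
  then show ?thesis
    using subspace_0[OF subspace_filtration] by blast
qed

end

section \<open>From the derivation of the semidirect sum to a graded Heisenberg module\<close>

theorem theorem6p4:
  fixes sH :: "'p::prime_card mod_ring alg_closure \<Rightarrow> 'h::ab_group_add \<Rightarrow> 'h"
    and bH :: "'h \<Rightarrow> 'h \<Rightarrow> 'h"
    and sI :: "'p mod_ring alg_closure \<Rightarrow> 'i::ab_group_add \<Rightarrow> 'i"
    and \<psi> :: "'h \<Rightarrow> 'i \<Rightarrow> 'i"
    and \<delta> :: "'h \<times> 'i \<Rightarrow> 'h \<times> 'i"
  assumes "odd CARD('p)"
    and "heisenberg_algebra sH bH"
    and "lie_representation sH bH sI \<psi>"
    and "inj \<psi>"
    and "\<not> lie_algebra.nilpotent (module_prod.scale sH sI) (semidirect_bracket bH \<psi>)"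
    and "lie_algebra.derivation (module_prod.scale sH sI) (semidirect_bracket bH \<psi>) \<delta>"
    and "bij \<delta>"
    and "\<exists>n\<ge>1. \<delta> ^^ n = id"
    and "\<delta> ` ({0} \<times> UNIV) \<subseteq> {0} \<times> UNIV"
  shows "vector_space.edim sI \<ge> enat (CARD('p) + 3)"
proof -
  interpret H: heisenberg_algebra sH bH by fact
  interpret R: lie_representation sH bH sI \<psi> by fact
  let ?p = "CHAR('p mod_ring alg_closure)"
  have p: "?p = CARD('p)" "prime ?p"
    using prime_card[where ?'a = 'p] by auto
  have p_ge: "?p \<ge> 3"
    using p assms(1) prime_ge_2_nat[OF p(2)] by (cases "?p = 2") auto
  obtain n where n: "n \<ge> 1" "\<delta> ^^ n = id"
    using assms(8) by blast
  \<comment> \<open>Passing to a power of \<open>\<delta>\<close> with exponent a power of \<open>p\<close>, which is again a derivation, removes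
    the \<open>p\<close>-part of the order and so makes \<open>\<delta>\<close> diagonalizable.\<close>
  obtain m where m: "n = ?p ^ multiplicity ?p n * m" "\<not> ?p dvd m"
    using multiplicity_decompose'[of n ?p] n(1) not_prime_unit[of ?p] p(2) by (metis not_one_le_zero)
  define E where "E = \<delta> ^^ (?p ^ multiplicity ?p n)"
  have E_derivation: "R.S.derivation E"
    unfolding E_def by (rule R.S.derivation_funpow_CHAR_power[OF assms(6) p(2)])
  have E_order: "E ^^ m = id"
    unfolding E_def funpow_mult using m(1) n(2) by (simp add: mult.commute)
  have "(\<delta> ^^ k) ` ({0} \<times> UNIV) \<subseteq> {0} \<times> UNIV" for k
  proof (induction k)
    case (Suc k)
    then show ?case
      using assms(9) unfolding funpow.simps image_comp[symmetric] by (meson image_mono order_trans)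
  qed simp
  then have E_invariant: "E ` ({0} \<times> UNIV) \<subseteq> {0} \<times> UNIV"
    unfolding E_def .
  obtain d D where d: "Vector_Spaces.linear sH sH d" and D: "Vector_Spaces.linear sI sI D"
    and fst_E: "\<And>h v. fst (E (h, v)) = d h" and E_D: "\<And>v. E (0, v) = (0, D v)"
    and d_bracket: "\<And>u v. d (bH u v) = bH (d u) v + bH u (d v)"
    and D_rep: "\<And>h v. D (\<psi> h v) = \<psi> (d h) v + \<psi> h (D v)"
    by (rule R.semidirect_derivation_components[OF E_derivation E_invariant]) (rule that)
  have "fst ((E ^^ k) (h, v)) = (d ^^ k) h" for k h v
    using fst_E by (induction k) (simp_all, metis prod.collapse)
  then have d_order: "d ^^ m = id"
    by (metis (no_types, opaque_lifting) E_order eq_id_iff fst_conv)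
  have "(E ^^ k) (0, v) = (0, (D ^^ k) v)" for k v
    by (induction k) (simp_all add: E_D)
  then have D_order: "D ^^ m = id"
    by (metis (no_types, opaque_lifting) E_order eq_id_iff snd_conv)
  have m_nonzero: "of_nat m \<noteq> (0 :: 'p mod_ring alg_closure)"
    using m(2) by (simp only: of_nat_eq_0_iff_char_dvd not_False_eq_True)
  interpret dH: finite_order_endomorphism sH d m
    by (intro finite_order_endomorphism.intro finite_order_endomorphism_axioms.intro
        H.vector_space_axioms d d_order m_nonzero)
  interpret DI: finite_order_endomorphism sI D m
    by (intro finite_order_endomorphism.intro finite_order_endomorphism_axioms.intro
        R.V.vector_space_axioms D D_order m_nonzero)

  \<comment> \<open>A non-commuting pair of eigenvectors: \<open>x\<close> is taken outside the
    center, then \<open>y\<close> outside the centralizer of \<open>x\<close>.\<close>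
  have "{u. \<forall>v. bH u v = 0} \<noteq> UNIV"
    using H.bracket_nonzero by auto
  then obtain x a where x: "x \<notin> {u. \<forall>v. bH u v = 0}" "d x = sH a x"
    using dH.exists_eigenvector_notin[OF H.subspace_center] by metis
  then have "{v. bH x v = 0} \<noteq> UNIV"
    by auto
  then obtain y b where y: "y \<notin> {v. bH x v = 0}" "d y = sH b y"
    using dH.exists_eigenvector_notin[OF H.subspace_centralizer] by metis
  define z where "z = bH x y"
  have z: "z \<noteq> 0" "d z = sH (a + b) z"
    using y by (simp_all add: z_def d_bracket x(2) H.bracket_scale_left H.bracket_scale_right
        H.scale_left_distrib)
  have span_xyz: "H.span {x, y, z} = UNIV"
    unfolding z_def by (rule H.span_noncommuting) (use z in \<open>simp add: z_def\<close>)
  have "x \<noteq> 0" "y \<noteq> 0"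
    using z(1) by (auto simp: z_def)
  \<comment> \<open>The eigenvalues are roots of unity; this applies to \<open>a + b\<close> too,
    since \<open>z\<close> is a nonzero eigenvector.\<close>
  then have nonzero: "a \<noteq> 0" "b \<noteq> 0" "a + b \<noteq> 0"
    using dH.eigenvalue_root_of_unity[OF x(2)] dH.eigenvalue_root_of_unity[OF y(2)]
      dH.eigenvalue_root_of_unity[OF z(2) z(1)] dH.m_pos by (auto simp: power_0_left)

  show ?thesis
  proof (cases "\<exists>B. finite B \<and> R.V.span B = UNIV")
    case False
    then show ?thesis
      unfolding R.V.edim_def if_not_P[OF False] by simp
  next
    case True
    then obtain B\<^sub>0 where B\<^sub>0: "finite B\<^sub>0" "R.V.span B\<^sub>0 = UNIV"
      by blast
    obtain B where B: "B \<subseteq> B\<^sub>0" "R.V.independent B" "B\<^sub>0 \<subseteq> R.V.span B"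
      using R.V.maximal_independent_subset by metis
    have "R.V.span B = UNIV"
      using B(3) B\<^sub>0(2) R.V.span_minimal[OF B(3) R.V.subspace_span] by auto
    then interpret finite_dimensional_vector_space sI B
      using B B\<^sub>0(1) finite_subset by unfold_locales auto
    interpret graded_heisenberg_module sI D m B "\<psi> x" "\<psi> y" "\<psi> z" a b
    proof (intro graded_heisenberg_module.intro graded_heisenberg_module_axioms.intro
        DI.finite_order_endomorphism_axioms finite_dimensional_vector_space_axioms)
      show "\<psi> x (\<psi> y u) - \<psi> y (\<psi> x u) = \<psi> z u" for u
        by (simp add: z_def R.rep_bracket)
      have "\<psi> h (\<psi> z u) = \<psi> z (\<psi> h u)" for h u
        using R.rep_bracket[of h z u] by (simp add: z_def H.bracket_bracket)
      then show "\<psi> x (\<psi> z u) = \<psi> z (\<psi> x u)" "\<psi> y (\<psi> z u) = \<psi> z (\<psi> y u)" for u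
        by blast+
    qed (simp_all add: R.rep_linear D_rep x(2) y(2) z(2) R.rep_scale nonzero add.commute)
    \<comment> \<open>Faithfulness enters here: \<open>z\<close> acts nontrivially.\<close>
    have "\<psi> z \<noteq> \<psi> 0"
      using z(1) inj_eq[OF assms(4)] by simp
    then obtain u where u: "\<psi> z u \<noteq> 0"
      by fastforce
    \<comment> \<open>If all three acted nilpotently, the filtration would reach zero and, as
      \<open>x\<close>, \<open>y\<close>, \<open>z\<close> span the Heisenberg algebra, the
      semidirect sum would be nilpotent.\<close>
    have "eventual_preimage (\<psi> x) {0} \<noteq> UNIV \<or> eventual_preimage (\<psi> y) {0} \<noteq> UNIV \<or>
      eventual_preimage (\<psi> z) {0} \<noteq> UNIV"
    proof (rule ccontr)
      assume "\<not> ?thesis"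
      then obtain k where k: "filtration k = {0}"
        using filtration_trivial by blast
      have step: "\<psi> h w \<in> filtration (Suc i)" if "w \<in> filtration i" for h w i
      proof -
        have "H.subspace {h. \<psi> h w \<in> filtration (Suc i)}"
          using subspace_filtration[of "Suc i"]
          by (auto intro!: H.subspaceI simp: R.rep_add R.rep_scale R.V.subspace_0 R.V.subspace_add
              R.V.subspace_scale)
        then have "H.span {x, y, z} \<subseteq> {h. \<psi> h w \<in> filtration (Suc i)}"
          using filtration_step[OF that] by (intro H.span_minimal) auto
        then show ?thesis
          unfolding span_xyz by auto
      qed
      show False
        using assms(5) R.semidirect_nilpotent[OF H.bracket_bracket subspace_filtration step
            filtration_0 k] by blast
    qed
    then have "R.V.dim UNIV \<ge> ?p + 3"
      using u p_ge by (rule dim_ge)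
    then show ?thesis
      unfolding R.V.edim_def if_P[OF True] using p(1) by simp
  qed
qed

end
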